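(* Let $n>1$ be an integer. There exists a contactomorphism $\varphi:S^{2n-1}\to S^{2n-1}$ of the standard contact sphere $(S^{2n-1},\alpha_{\mathrm{std}})$ that is isotopic to the identity and has no translated points with respect to the contact form $\alpha_{\mathrm{std}}$.
   Context: Let $Y$ be a manifold of dimension $2n-1$ with a contact form $\alpha$, i.e. a $1$-form such that $\alpha\wedge (d\alpha)^{n-1}$ is a volume form. A contactomorphism of $(Y,\alpha)$ is a diffeomorphism $\varphi:Y\to Y$ such that $\varphi^{*}\alpha=e^{g}\alpha$ for some smooth function $g:Y\to\mathbb{R}$, called the scaling factor of $\varphi$. "Isotopic to the identity" means joined to the identity by a smooth path of contactomorphisms. The Reeb field $R$ of $\alpha$ is the vector field characterized by $\alpha(R)=1$ and $d\alpha(R,-)=0$. A point $p\in Y$ is a translated point of $\varphi$ (with respect to $\alpha$) if $g(p)=0$ and $\varphi(p)$ lies on the Reeb flow line passing through $p$. The sphere $S^{2n-1}$ is the unit sphere in $\mathbb{R}^{2n}=\mathbb{C}^n$ with coordinates $z_i=x_i+iy_i$, and $\alpha_{\mathrm{std}}$ is the restriction to $S^{2n-1}$ of $\sum_{i=1}^{n}(x_i\,dy_i-y_i\,dx_i)$. Its Reeb flow lines are $t\mapsto (e^{it}z_1,\dots,e^{it}z_n)$, i.e. the fibers of the Hopf fibration. *)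

theory Defs
  imports "HOL-Analysis.Analysis"
begin

text \<open>
  Being \<open>C\<^sup>k\<close> on an open set \<open>U\<close>. On Euclidean spaces this is the usual notion: all iterated
  directional derivatives up to order \<open>k\<close> exist and are continuous.
\<close>

primrec Ck_on ::
  "nat \<Rightarrow> ('a::real_normed_vector \<Rightarrow> 'b::real_normed_vector) \<Rightarrow> 'a set \<Rightarrow> bool" where
  "Ck_on 0 f U \<longleftrightarrow> continuous_on U f"
| "Ck_on (Suc k) f U \<longleftrightarrow>
     (\<forall>x\<in>U. f differentiable (at x)) \<and>
     (\<forall>v. Ck_on k (\<lambda>x. frechet_derivative f (at x) v) U)"

text \<open>
  Smoothness on an arbitrary subset of a Euclidean space means local extendability to a smooth map
  on an open set. For an embedded submanifold, with or without boundary, this is smoothness in the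
  intrinsic sense.
\<close>

definition smooth_on ::
  "'a::euclidean_space set \<Rightarrow> ('a \<Rightarrow> 'b::euclidean_space) \<Rightarrow> bool" where
  "smooth_on A f \<longleftrightarrow>
     (\<forall>x\<in>A. \<exists>U h. open U \<and> x \<in> U \<and> (\<forall>k. Ck_on k h U) \<and> (\<forall>y\<in>A \<inter> U. h y = f y))"

text \<open>
  The space \<open>\<complex>\<^sup>n\<close> is \<^typ>\<open>complex ^ 'n\<close> with \<open>n = CARD('n)\<close>, a real Euclidean space of dimension
  \<open>2n\<close>; \<open>\<bullet>\<close> is its real inner product. Maps of the sphere are total functions on \<open>\<complex>\<^sup>n\<close> whose values
  off the sphere are irrelevant.
\<close>

abbreviation unit_sphere :: "(complex ^ 'n) set" where
  "unit_sphere \<equiv> sphere 0 1"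

definition tangent_space :: "complex ^ 'n \<Rightarrow> (complex ^ 'n) set" where
  "tangent_space p = {v. p \<bullet> v = 0}"

text \<open>
  A 1-form on \<open>\<complex>\<^sup>n\<close> sends a point and a vector to a real number. Forms on the sphere are given by
  forms on \<open>\<complex>\<^sup>n\<close>, evaluated only at points of the sphere and on vectors tangent to it. Since the
  exterior derivative commutes with restriction, \<open>d\<alpha>\<close> may be computed on \<open>\<complex>\<^sup>n\<close>; the formula is
  \<open>d\<alpha>(u, v) = u(\<alpha>(v)) - v(\<alpha>(u))\<close> for constant vector fields \<open>u\<close> and \<open>v\<close>.
\<close>

type_synonym 'n one_form = "complex ^ 'n \<Rightarrow> complex ^ 'n \<Rightarrow> real"

definition ext_deriv ::
  "'n::finite one_form \<Rightarrow> complex ^ 'n \<Rightarrow> complex ^ 'n \<Rightarrow> complex ^ 'n \<Rightarrow> real" where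
  "ext_deriv \<alpha> p u v =
     frechet_derivative (\<lambda>q. \<alpha> q v) (at p) u - frechet_derivative (\<lambda>q. \<alpha> q u) (at p) v"

definition alpha_std :: "'n::finite one_form" where
  "alpha_std z v = (\<Sum>i\<in>UNIV. Re (z $ i) * Im (v $ i) - Im (z $ i) * Re (v $ i))"

definition sphere_diffeo :: "(complex ^ 'n \<Rightarrow> complex ^ 'n) \<Rightarrow> bool" where
  "sphere_diffeo \<phi> \<longleftrightarrow>
     bij_betw \<phi> unit_sphere unit_sphere \<and>
     smooth_on unit_sphere \<phi> \<and> smooth_on unit_sphere (inv_into unit_sphere \<phi>)"

text \<open>
  The condition \<open>\<phi>\<^sup>*\<alpha> = e\<^sup>g \<alpha>\<close>. A derivative of \<open>\<phi>\<close> within the sphere is determined only on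
  tangent vectors, and it is applied only to these.
\<close>

definition scaling_factor ::
  "'n::finite one_form \<Rightarrow> (complex ^ 'n \<Rightarrow> complex ^ 'n) \<Rightarrow> (complex ^ 'n \<Rightarrow> real) \<Rightarrow> bool" where
  "scaling_factor \<alpha> \<phi> g \<longleftrightarrow>
     smooth_on unit_sphere g \<and>
     (\<forall>p\<in>unit_sphere. \<forall>v\<in>tangent_space p.
        \<alpha> (\<phi> p) (frechet_derivative \<phi> (at p within unit_sphere) v) = exp (g p) * \<alpha> p v)"

definition contactomorphism ::
  "'n::finite one_form \<Rightarrow> (complex ^ 'n \<Rightarrow> complex ^ 'n) \<Rightarrow> bool" where
  "contactomorphism \<alpha> \<phi> \<longleftrightarrow> sphere_diffeo \<phi> \<and> (\<exists>g. scaling_factor \<alpha> \<phi> g)"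

definition contact_isotopic_to_id ::
  "'n::finite one_form \<Rightarrow> (complex ^ 'n \<Rightarrow> complex ^ 'n) \<Rightarrow> bool" where
  "contact_isotopic_to_id \<alpha> \<phi> \<longleftrightarrow>
     (\<exists>\<Phi> :: real \<Rightarrow> complex ^ 'n \<Rightarrow> complex ^ 'n.
        smooth_on ({0..1} \<times> unit_sphere) (\<lambda>(t, z). \<Phi> t z) \<and>
        (\<forall>t\<in>{0..1}. contactomorphism \<alpha> (\<Phi> t)) \<and>
        (\<forall>z\<in>unit_sphere. \<Phi> 0 z = z) \<and>
        (\<forall>z\<in>unit_sphere. \<Phi> 1 z = \<phi> z))"

definition reeb_field ::
  "'n::finite one_form \<Rightarrow> (complex ^ 'n \<Rightarrow> complex ^ 'n) \<Rightarrow> bool" where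
  "reeb_field \<alpha> R \<longleftrightarrow>
     (\<forall>p\<in>unit_sphere. R p \<in> tangent_space p \<and> \<alpha> p (R p) = 1 \<and>
        (\<forall>v\<in>tangent_space p. ext_deriv \<alpha> p (R p) v = 0))"

definition reeb_flow_line ::
  "'n::finite one_form \<Rightarrow> (real \<Rightarrow> complex ^ 'n) \<Rightarrow> bool" where
  "reeb_flow_line \<alpha> \<gamma> \<longleftrightarrow>
     (\<exists>R. reeb_field \<alpha> R \<and>
        (\<forall>t. \<gamma> t \<in> unit_sphere \<and> (\<gamma> has_vector_derivative R (\<gamma> t)) (at t)))"

text \<open>
  The scaling factor of a contactomorphism is unique on the sphere, so the existential quantifier
  over \<open>g\<close> below involves no choice.
\<close>

definition translated_point ::
  "'n::finite one_form \<Rightarrow> (complex ^ 'n \<Rightarrow> complex ^ 'n) \<Rightarrow> complex ^ 'n \<Rightarrow> bool" where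
  "translated_point \<alpha> \<phi> p \<longleftrightarrow>
     p \<in> unit_sphere \<and>
     (\<exists>g. scaling_factor \<alpha> \<phi> g \<and> g p = 0) \<and>
     (\<exists>\<gamma>. reeb_flow_line \<alpha> \<gamma> \<and> p \<in> range \<gamma> \<and> \<phi> p \<in> range \<gamma>)"

end

theory Submission
  imports Defs
begin

text \<open>
  Fix two coordinates \<open>i \<noteq> j\<close>. The holomorphic automorphisms of the unit ball in \<open>\<complex>\<^sup>n\<close>, which form the group
  \<open>PU(n, 1)\<close>, act on the boundary sphere by contactomorphisms, and among them there is already one
  without translated points.

  For \<open>a\<^sup>2 + b\<^sup>2 = 1\<close>, \<open>b \<noteq> 0\<close>, the boost along the \<open>i\<close>-axis sends \<open>z\<close> to the point with \<open>i\<close>-th coordinate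
  \<open>(z\<^sub>i + a) / D\<close> and the other coordinates \<open>b z\<^sub>k / D\<close>, where \<open>D = 1 + a z\<^sub>i\<close>. It multiplies
  \<open>\<alpha>\<close> by \<open>b\<^sup>2 / |D|\<^sup>2\<close> (\<open>alpha_std_boost\<close>). Let \<open>\<phi>\<close> be the boost with \<open>a = 24/25\<close>, \<open>b = 7/25\<close>, followed by
  the rotation \<open>(w\<^sub>i, w\<^sub>j) \<mapsto> (- w\<^sub>j, w\<^sub>i)\<close>, which preserves \<open>\<alpha>\<close>. Suppose that \<open>p\<close> is a translated point.
  The scaling factor vanishes at \<open>p\<close>, so \<open>|D| = b\<close>, and this has two consequences.

  \<^item> By the triangle inequality \<open>a |p\<^sub>i| \<ge> 1 - |D| = 1 - b\<close>, so \<open>|p\<^sub>i| \<ge> 3/4\<close>.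
  \<^item> The factor \<open>b / D\<close> has modulus \<open>1\<close>, so \<open>|\<phi>(p)\<^sub>i| = |b p\<^sub>j / D| = |p\<^sub>j|\<close>.

  The Reeb flow preserves the modulus of every coordinate (\<open>reeb_flow_line_norm_nth\<close>), so
  \<open>|p\<^sub>i| = |\<phi>(p)\<^sub>i| = |p\<^sub>j|\<close>, whence \<open>|p\<^sub>i|\<^sup>2 + |p\<^sub>j|\<^sup>2 \<ge> 9/8 > 1\<close>, which is impossible on the unit sphere.

  A path from the identity to \<open>\<phi>\<close> is obtained by moving the pair \<open>(b, a)\<close> and the rotation angle along
  the rational parametrization of the unit circle. Every map in sight is then a rational
  function of the point and of the time, so smoothness follows from closure of \<open>C\<^sup>k\<close> maps under sums,
  products and inverses; the scaling factor needs the logarithm as well.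
\<close>

section \<open>Calculus of \<open>C\<^sup>k\<close> maps\<close>

lemma Ck_on_cong:
  assumes "open U" and "\<And>x. x \<in> U \<Longrightarrow> f x = g x" and "Ck_on k f U"
  shows "Ck_on k g U"
  using assms(2,3)
proof (induction k arbitrary: f g)
  case 0
  then show ?case by (simp cong: continuous_on_cong)
next
  case (Suc k)
  have D: "(g has_derivative frechet_derivative f (at x)) (at x)" if "x \<in> U" for x
    using Suc.prems that \<open>open U\<close> frechet_derivative_works
      has_derivative_transform_within_open[of f _ x UNIV U g] by force
  have "frechet_derivative f (at x) = frechet_derivative g (at x)" if "x \<in> U" for x
    using frechet_derivative_at[OF D[OF that]] .
  moreover have "Ck_on k (\<lambda>x. frechet_derivative f (at x) v) U" for v
    using Suc.prems by simp
  ultimately have "Ck_on k (\<lambda>x. frechet_derivative g (at x) v) U" for v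
    using Suc.IH[of "\<lambda>x. frechet_derivative f (at x) v" "\<lambda>x. frechet_derivative g (at x) v"]
    by simp
  with D show ?case
    by (auto simp: differentiable_def)
qed

text \<open>
  The working form of the recursion for \<^const>\<open>Ck_on\<close>: any formula for the derivative may replace
  \<^const>\<open>frechet_derivative\<close>. With it the closure properties below all go by induction on the order,
  each differentiation rule expressing the derivative through maps that are covered by the
  induction hypothesis.
\<close>

lemma Ck_on_SucI:
  assumes "open U"
    and D: "\<And>x. x \<in> U \<Longrightarrow> (f has_derivative f' x) (at x)"
    and "\<And>v. Ck_on k (\<lambda>x. f' x v) U"
  shows "Ck_on (Suc k) f U"
proof -
  have "f' x v = frechet_derivative f (at x) v" if "x \<in> U" for x v
    using frechet_derivative_at[OF D[OF that]] by simp
  then have "Ck_on k (\<lambda>x. frechet_derivative f (at x) v) U" for v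
    using Ck_on_cong[OF \<open>open U\<close>, of "\<lambda>x. f' x v" "\<lambda>x. frechet_derivative f (at x) v"] assms(3)
    by simp
  with D show ?thesis
    by (auto simp: differentiable_def)
qed

lemma Ck_on_Suc_derivative:
  assumes "Ck_on (Suc k) f U"
  shows "x \<in> U \<Longrightarrow> (f has_derivative frechet_derivative f (at x)) (at x)"
    and "Ck_on k (\<lambda>x. frechet_derivative f (at x) v) U"
  using assms frechet_derivative_works by auto

lemma Ck_on_SucD:
  assumes "Ck_on (Suc k) f U"
  shows "Ck_on k f U"
  using assms
proof (induction k arbitrary: f)
  case 0
  then show ?case
    by (auto intro!: differentiable_imp_continuous_on
        simp: differentiable_on_def differentiable_at_withinI)
next
  case (Suc k)
  then show ?case by (metis Ck_on.simps(2))
qed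

lemma Ck_on_const: "Ck_on k (\<lambda>x. c) U"
proof (induction k arbitrary: c)
  case (Suc k)
  then show ?case by simp
qed simp

lemma Ck_on_bounded_linear:
  assumes L: "bounded_linear L" and "open U" "Ck_on k f U"
  shows "Ck_on k (\<lambda>x. L (f x)) U"
  using assms(3)
proof (induction k arbitrary: f)
  case 0
  then show ?case by (simp add: bounded_linear.continuous_on[OF L])
next
  case (Suc k)
  show ?case
  proof (rule Ck_on_SucI[OF \<open>open U\<close>])
    show "((\<lambda>x. L (f x)) has_derivative (\<lambda>v. L (frechet_derivative f (at x) v))) (at x)"
      if "x \<in> U" for x
      using bounded_linear.has_derivative[OF L Ck_on_Suc_derivative(1)[OF Suc.prems that]] .
    show "Ck_on k (\<lambda>x. L (frechet_derivative f (at x) v)) U" for v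
      using Suc.IH Ck_on_Suc_derivative(2)[OF Suc.prems] by blast
  qed
qed

lemma Ck_on_id:
  assumes "open U"
  shows "Ck_on k (\<lambda>x. x) U"
proof (cases k)
  case (Suc m)
  then show ?thesis
    using Ck_on_SucI[OF assms has_derivative_ident Ck_on_const] by simp
qed simp

lemma Ck_on_add:
  assumes "open U" "Ck_on k f U" "Ck_on k g U"
  shows "Ck_on k (\<lambda>x. f x + g x) U"
  using assms(2,3)
proof (induction k arbitrary: f g)
  case 0
  then show ?case by (simp add: continuous_on_add)
next
  case (Suc k)
  show ?case
  proof (rule Ck_on_SucI[OF \<open>open U\<close>])
    show "((\<lambda>x. f x + g x) has_derivative
        (\<lambda>v. frechet_derivative f (at x) v + frechet_derivative g (at x) v)) (at x)"
      if "x \<in> U" for x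
      using Suc.prems that by (intro has_derivative_add Ck_on_Suc_derivative)
    show "Ck_on k (\<lambda>x. frechet_derivative f (at x) v + frechet_derivative g (at x) v) U" for v
      using Suc.prems by (intro Suc.IH Ck_on_Suc_derivative)
  qed
qed

lemma Ck_on_sum:
  assumes "open U" "\<And>i. i \<in> I \<Longrightarrow> Ck_on k (f i) U"
  shows "Ck_on k (\<lambda>x. \<Sum>i\<in>I. f i x) U"
  using assms(2)
  by (induction I rule: infinite_finite_induct) (auto intro: Ck_on_const Ck_on_add \<open>open U\<close>)

lemma Ck_on_bounded_bilinear:
  assumes B: "bounded_bilinear B" and "open U" "Ck_on k f U" "Ck_on k g U"
  shows "Ck_on k (\<lambda>x. B (f x) (g x)) U"
  using assms(3,4)
proof (induction k arbitrary: f g)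
  case 0
  then show ?case by (simp add: bounded_bilinear.continuous_on[OF B])
next
  case (Suc k)
  show ?case
  proof (rule Ck_on_SucI[OF \<open>open U\<close>])
    show "((\<lambda>x. B (f x) (g x)) has_derivative
        (\<lambda>v. B (f x) (frechet_derivative g (at x) v) + B (frechet_derivative f (at x) v) (g x)))
        (at x)" if "x \<in> U" for x
      using Suc.prems that by (intro bounded_bilinear.FDERIV[OF B] Ck_on_Suc_derivative)
    show "Ck_on k (\<lambda>x. B (f x) (frechet_derivative g (at x) v) +
        B (frechet_derivative f (at x) v) (g x)) U" for v
      using Suc.prems
      by (intro Ck_on_add[OF \<open>open U\<close>] Suc.IH Ck_on_Suc_derivative(2)) (auto intro: Ck_on_SucD)
  qed
qed

lemmas Ck_on_mult = Ck_on_bounded_bilinear[OF bounded_bilinear_mult]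

text \<open>
  The derivative of \<open>1/f\<close> involves only \<open>f'\<close> and \<open>1/f\<close> itself, and the latter is \<open>C\<^sup>k\<close> by the induction
  hypothesis.
\<close>

lemma Ck_on_inverse:
  fixes f :: "'a::real_normed_vector \<Rightarrow> 'b::real_normed_field"
  assumes "open U" "Ck_on k f U" and nz: "\<And>x. x \<in> U \<Longrightarrow> f x \<noteq> 0"
  shows "Ck_on k (\<lambda>x. inverse (f x)) U"
  using assms(2)
proof (induction k)
  case 0
  then show ?case using nz by (simp add: continuous_on_inverse)
next
  case (Suc k)
  have inv: "Ck_on k (\<lambda>x. inverse (f x)) U"
    using Suc by (simp only: Ck_on_SucD)
  show ?case
  proof (rule Ck_on_SucI[OF \<open>open U\<close>])
    show "((\<lambda>x. inverse (f x)) has_derivative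
        (\<lambda>v. - (inverse (f x) * frechet_derivative f (at x) v * inverse (f x)))) (at x)"
      if "x \<in> U" for x
      using nz that Suc.prems by (intro Deriv.has_derivative_inverse Ck_on_Suc_derivative)
    show "Ck_on k (\<lambda>x. - (inverse (f x) * frechet_derivative f (at x) v * inverse (f x))) U" for v
      using Suc.prems
      by (intro Ck_on_bounded_linear[OF bounded_linear_minus[OF bounded_linear_ident]]
          Ck_on_mult inv \<open>open U\<close> Ck_on_Suc_derivative(2))
  qed
qed

lemma Ck_on_ln:
  fixes f :: "'a::real_normed_vector \<Rightarrow> real"
  assumes "open U" "Ck_on k f U" and pos: "\<And>x. x \<in> U \<Longrightarrow> f x > 0"
  shows "Ck_on k (\<lambda>x. ln (f x)) U"
proof (cases k)
  case 0
  have "continuous_on U f \<Longrightarrow> continuous_on U (\<lambda>x. ln (f x))"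
    using pos by (intro continuous_on_ln) force+
  then show ?thesis using assms(2) 0 by simp
next
  case (Suc m)
  have "Ck_on (Suc m) (\<lambda>x. ln (f x)) U"
  proof (rule Ck_on_SucI[OF \<open>open U\<close>])
    show "((\<lambda>x. ln (f x)) has_derivative
        (\<lambda>v. frechet_derivative f (at x) v * inverse (f x))) (at x)"
      if "x \<in> U" for x
      using assms(2) Suc that pos by (intro has_derivative_ln Ck_on_Suc_derivative(1)) auto
    show "Ck_on m (\<lambda>x. frechet_derivative f (at x) v * inverse (f x)) U" for v
      using assms(2) Suc pos
      by (intro Ck_on_mult Ck_on_inverse \<open>open U\<close> Ck_on_Suc_derivative(2))
        (auto intro: Ck_on_SucD dest: pos)
  qed
  with Suc show ?thesis by simp
qed

lemma bounded_linear_axis: "bounded_linear (axis k :: 'a::euclidean_space \<Rightarrow> 'a ^ 'n)"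
  by (intro linear_conv_bounded_linear[THEN iffD1] linearI)
    (auto simp: vec_eq_iff axis_def)

lemma has_derivative_vec:
  fixes f :: "'a::real_normed_vector \<Rightarrow> 'b::euclidean_space ^ 'n"
  assumes "\<And>k. ((\<lambda>x. f x $ k) has_derivative (\<lambda>v. f' v $ k)) F"
  shows "(f has_derivative f') F"
proof -
  have eq: "g = (\<lambda>x. \<Sum>k\<in>UNIV. axis k (g x $ k))" for g :: "'a \<Rightarrow> 'b ^ 'n"
    by (auto simp: fun_eq_iff vec_eq_iff axis_def)
  have "((\<lambda>x. \<Sum>k\<in>UNIV. axis k (f x $ k)) has_derivative
      (\<lambda>v. \<Sum>k\<in>UNIV. axis k (f' v $ k))) F"
    by (intro has_derivative_sum bounded_linear.has_derivative[OF bounded_linear_axis] assms)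
  then show ?thesis
    unfolding eq[of f, symmetric] eq[of f', symmetric] .
qed

lemma Ck_on_vec:
  fixes f :: "'a::real_normed_vector \<Rightarrow> 'b::euclidean_space ^ 'n"
  assumes "open U" "\<And>k. Ck_on m (\<lambda>x. f x $ k) U"
  shows "Ck_on m f U"
proof -
  have "f = (\<lambda>x. \<Sum>k\<in>UNIV. axis k (f x $ k))"
    by (auto simp: fun_eq_iff vec_eq_iff axis_def)
  moreover have "Ck_on m (\<lambda>x. \<Sum>k\<in>UNIV. axis k (f x $ k)) U"
    by (intro Ck_on_sum Ck_on_bounded_linear[OF bounded_linear_axis] assms)
  ultimately show ?thesis by simp
qed

lemma Ck_on_nth:
  "open U \<Longrightarrow> Ck_on m f U \<Longrightarrow> Ck_on m (\<lambda>x. f x $ k) U"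
  by (rule Ck_on_bounded_linear[OF bounded_linear_vec_nth])

lemma Ck_on_complex_of_real:
  "open U \<Longrightarrow> Ck_on m f U \<Longrightarrow> Ck_on m (\<lambda>x. complex_of_real (f x)) U"
  by (rule Ck_on_bounded_linear[OF bounded_linear_of_real])

section \<open>Contact geometry of the standard sphere\<close>

text \<open>
  The standard contact form is the imaginary part of this form and the sphere is its unit level set,
  so a single computation with \<open>herm\<close> serves both.
\<close>

definition herm :: "complex ^ 'n \<Rightarrow> complex ^ 'n \<Rightarrow> complex" where
  "herm z v = (\<Sum>k\<in>UNIV. cnj (z $ k) * v $ k)"

lemma alpha_std_eq_Im_herm: "alpha_std z v = Im (herm z v)"
  by (simp add: alpha_std_def herm_def)

lemma herm_self: "herm z z = complex_of_real ((norm z)\<^sup>2)"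
proof -
  have "(norm z)\<^sup>2 = (\<Sum>k\<in>UNIV. (norm (z $ k))\<^sup>2)"
    by (simp add: norm_vec_def L2_set_def sum_nonneg)
  then show ?thesis
    by (simp add: herm_def complex_norm_square mult.commute flip: of_real_power)
qed

lemma herm_remove:
  "herm z v = cnj (z $ i) * v $ i + (\<Sum>k\<in>UNIV - {i}. cnj (z $ k) * v $ k)"
  unfolding herm_def by (rule sum.remove) auto

lemma mem_unit_sphere_iff_herm: "z \<in> unit_sphere \<longleftrightarrow> herm z z = 1"
  unfolding herm_self of_real_eq_1_iff
  by (auto simp: power2_eq_1_iff dest: order_trans[OF norm_ge_zero eq_refl])

lemma alpha_std_eq_inner: "alpha_std z v = (\<i> *s z) \<bullet> v"
  by (simp add: alpha_std_def inner_vec_def inner_complex_def algebra_simps sum_subtractf)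

lemma alpha_std_antisym: "alpha_std u v = - alpha_std v u"
  by (simp add: alpha_std_def algebra_simps flip: sum_negf)

lemma ext_deriv_alpha_std: "ext_deriv alpha_std p u v = 2 * alpha_std u v"
proof -
  have "bounded_linear (\<lambda>q. alpha_std q w)" for w :: "complex ^ 'a"
    unfolding linear_conv_bounded_linear[symmetric]
    by (intro linearI)
      (simp_all add: alpha_std_def algebra_simps sum.distrib sum_subtractf sum_distrib_left)
  then have "frechet_derivative (\<lambda>q. alpha_std q w) (at p) = (\<lambda>q. alpha_std q w)" for w
    using frechet_derivative_at[OF bounded_linear_imp_has_derivative] by metis
  then show ?thesis
    using alpha_std_antisym[of v u] by (simp add: ext_deriv_def)
qed

text \<open>
  Since \<open>d\<alpha>(u, v) = 2 (\<i>u \<bullet> v)\<close>, the condition \<open>d\<alpha>(R, -) = 0\<close> on the tangent space makes \<open>\<i>R\<close> normal to the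
  sphere, that is, a multiple of \<open>p\<close>. The normalization \<open>\<alpha>(R) = 1\<close> determines the multiple.
\<close>

lemma reeb_field_alpha_std:
  assumes R: "reeb_field alpha_std R" and p: "p \<in> unit_sphere"
  shows "R p = \<i> *s p"
proof -
  define c where "c = (\<i> *s R p) \<bullet> p"
  define v where "v = \<i> *s R p - c *\<^sub>R p"
  have pp: "p \<bullet> p = 1" using p by (simp add: norm_eq_1)
  have "p \<bullet> v = 0"
    by (simp add: v_def c_def inner_diff_right pp inner_commute)
  then have "alpha_std (R p) v = 0" and one: "alpha_std p (R p) = 1"
    using R p by (auto simp: reeb_field_def tangent_space_def ext_deriv_alpha_std)
  then have "(\<i> *s R p) \<bullet> v = 0" by (simp add: alpha_std_eq_inner)
  with \<open>p \<bullet> v = 0\<close> have "v \<bullet> v = 0"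
    by (simp add: v_def inner_diff_left)
  then have eq: "\<i> *s R p = c *\<^sub>R p" by (simp add: v_def)
  have "c = alpha_std (R p) p" by (simp add: c_def alpha_std_eq_inner)
  with one have "c = - 1" using alpha_std_antisym[of p "R p"] by simp
  then have "\<i> * R p $ k = - p $ k" for k
    using arg_cong[OF eq, of "\<lambda>w. w $ k"] by simp
  then have "\<i> * (\<i> * R p $ k) = \<i> * (- p $ k)" for k
    by simp
  then show ?thesis by (simp add: vec_eq_iff)
qed

text \<open>
  A Reeb flow line satisfies \<open>\<gamma>' = \<i>\<gamma>\<close>, and \<open>\<i>\<gamma>\<^sub>k\<close> is orthogonal to \<open>\<gamma>\<^sub>k\<close>. Hence
  the moduli of the coordinates are constant along flow lines.
\<close>

lemma reeb_flow_line_norm_nth: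
  assumes "reeb_flow_line alpha_std \<gamma>" and "z \<in> range \<gamma>" "w \<in> range \<gamma>"
  shows "norm (z $ k) = norm (w $ k)"
proof -
  obtain R where R: "reeb_field alpha_std R" "\<And>t. \<gamma> t \<in> unit_sphere"
    "\<And>t. (\<gamma> has_vector_derivative R (\<gamma> t)) (at t)"
    using assms(1) unfolding reeb_flow_line_def by auto
  have "((\<lambda>t. \<gamma> t $ k \<bullet> \<gamma> t $ k) has_field_derivative 0) (at t)" for t
  proof -
    have "(\<gamma> has_vector_derivative \<i> *s \<gamma> t) (at t)"
      using R(3)[of t] reeb_field_alpha_std[OF R(1,2)] by simp
    from bounded_linear.has_vector_derivative[OF bounded_linear_vec_nth this, of k]
    have "((\<lambda>t. \<gamma> t $ k) has_vector_derivative \<i> * \<gamma> t $ k) (at t)" by simp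
    from has_derivative_inner[OF this[unfolded has_vector_derivative_def]
        this[unfolded has_vector_derivative_def]]
    have "((\<lambda>t. \<gamma> t $ k \<bullet> \<gamma> t $ k) has_derivative (\<lambda>h. 0)) (at t)"
      by (simp add: inner_complex_def algebra_simps)
    then show ?thesis by (simp add: has_field_derivative_def lambda_zero)
  qed
  then have "\<gamma> s $ k \<bullet> \<gamma> s $ k = \<gamma> t $ k \<bullet> \<gamma> t $ k" for s t
    using DERIV_isconst_all[of "\<lambda>t. \<gamma> t $ k \<bullet> \<gamma> t $ k"] by blast
  then show ?thesis using assms(2,3) by (auto simp: norm_eq_sqrt_inner)
qed

text \<open>
  Within the sphere \<^const>\<open>frechet_derivative\<close> is some derivative, arbitrary in the normal direction.
  Any two derivatives agree on a tangent vector \<open>v\<close>, because both give the velocity of the image of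
  a curve in the sphere with velocity \<open>v\<close>, here the projection of the line \<open>p + t v\<close> to the sphere.
\<close>

lemma sphere_derivative_unique:
  fixes f :: "complex ^ 'n \<Rightarrow> 'b::real_normed_vector"
  assumes p: "p \<in> unit_sphere" and v: "v \<in> tangent_space p"
    and D: "(f has_derivative f1) (at p within unit_sphere)"
      "(f has_derivative f2) (at p within unit_sphere)"
  shows "f1 v = f2 v"
proof -
  define \<gamma> where "\<gamma> t = (1 / sqrt (1 + t\<^sup>2 * (norm v)\<^sup>2)) *\<^sub>R (p + t *\<^sub>R v)" for t :: real
  have pos: "1 + t\<^sup>2 * (norm v)\<^sup>2 > 0" for t :: real
    by (simp add: add_pos_nonneg)
  have "\<gamma> t \<in> unit_sphere" for t
  proof -
    have "(norm (p + t *\<^sub>R v))\<^sup>2 = 1 + t\<^sup>2 * (norm v)\<^sup>2"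
      using p v unfolding power2_norm_eq_inner
      by (simp add: tangent_space_def algebra_simps inner_commute power2_eq_square norm_eq_1)
    then have "norm (p + t *\<^sub>R v) = sqrt (1 + t\<^sup>2 * (norm v)\<^sup>2)"
      by (metis norm_ge_zero real_sqrt_abs abs_of_nonneg)
    then show ?thesis using pos[of t] by (simp add: \<gamma>_def)
  qed
  then have range: "range \<gamma> \<subseteq> unit_sphere" by blast
  have "((\<lambda>t. 1 / sqrt (1 + t\<^sup>2 * (norm v)\<^sup>2)) has_field_derivative 0) (at 0)"
    by (auto intro!: derivative_eq_intros)
  moreover have "((\<lambda>t. p + t *\<^sub>R v) has_vector_derivative v) (at 0)"
    by (auto intro!: derivative_eq_intros)
  ultimately have "(\<gamma> has_vector_derivative v) (at 0)"
    unfolding \<gamma>_def by (auto intro!: derivative_eq_intros)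
  then have \<gamma>: "(\<gamma> has_derivative (\<lambda>h. h *\<^sub>R v)) (at 0)"
    by (simp add: has_vector_derivative_def)
  have \<gamma>0: "\<gamma> 0 = p" by (simp add: \<gamma>_def)
  have "((\<lambda>t. f (\<gamma> t)) has_derivative (\<lambda>h. f' (h *\<^sub>R v))) (at 0)"
    if "(f has_derivative f') (at p within unit_sphere)" for f'
    using has_derivative_in_compose[OF \<gamma>] has_derivative_subset[OF that range] \<gamma>0 by simp
  from has_derivative_unique[OF this[OF D(1)] this[OF D(2)]] show ?thesis
    by (metis scaleR_one)
qed

section \<open>Boosts and rotations\<close>

text \<open>
  For \<open>a = tanh r\<close> and \<open>b = 1 / cosh r\<close> this is the hyperbolic translation by \<open>r\<close> of the complex
  hyperbolic ball along the \<open>i\<close>-axis, extended to the boundary.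
\<close>

definition boost :: "'n \<Rightarrow> real \<Rightarrow> real \<Rightarrow> complex ^ 'n \<Rightarrow> complex ^ 'n" where
  "boost i a b z =
     (\<chi> k. (if k = i then z $ i + of_real a else of_real b * z $ k) / (1 + of_real a * z $ i))"

text \<open>
  The derivative at \<open>z\<close>, obtained by differentiating \<open>D \<cdot> boost = N\<close> with affine \<open>D\<close> and \<open>N\<close>. In this
  form it shows which part of the derivative is proportional to the image point itself.
\<close>

definition boost_deriv ::
  "'n \<Rightarrow> real \<Rightarrow> real \<Rightarrow> complex ^ 'n \<Rightarrow> complex ^ 'n \<Rightarrow> complex ^ 'n" where
  "boost_deriv i a b z v =
     (\<chi> k. ((if k = i then v $ i else of_real b * v $ k) - boost i a b z $ k * (of_real a * v $ i))
        / (1 + of_real a * z $ i))"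

definition rot :: "'n \<Rightarrow> 'n \<Rightarrow> real \<Rightarrow> real \<Rightarrow> complex ^ 'n \<Rightarrow> complex ^ 'n" where
  "rot i j c s z =
     (\<chi> k. if k = i then of_real c * z $ i - of_real s * z $ j
           else if k = j then of_real s * z $ i + of_real c * z $ j
           else z $ k)"

lemma boost_denominator_nonzero:
  fixes z :: "complex ^ 'n"
  assumes "\<bar>a\<bar> < 1" "z \<in> unit_sphere"
  shows "1 + of_real a * z $ i \<noteq> 0"
proof
  assume "1 + of_real a * z $ i = 0"
  then have "of_real a * z $ i = - 1" by (simp add: add_eq_0_iff)
  then have "\<bar>a\<bar> * norm (z $ i) = 1"
    by (metis norm_minus_cancel norm_mult norm_of_real norm_one)
  moreover have "norm (z $ i) \<le> 1"
    using assms(2) Finite_Cartesian_Product.norm_nth_le[of z i] by simp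
  then have "\<bar>a\<bar> * norm (z $ i) \<le> \<bar>a\<bar>" by (simp add: mult_left_le)
  ultimately show False using assms(1) by simp
qed

text \<open>
  With \<open>N\<close> and \<open>D\<close> the numerator and denominator of the boost, \<open>|N|\<^sup>2 - |D|\<^sup>2 = b\<^sup>2 (|z|\<^sup>2 - 1)\<close>: up to the
  factor \<open>b\<^sup>2\<close> the linear map \<open>(1, z) \<mapsto> (D, N)\<close> preserves the Hermitian form of signature \<open>(n, 1)\<close>.
\<close>

lemma boost_in_unit_sphere:
  fixes z :: "complex ^ 'n"
  assumes ab: "a\<^sup>2 + b\<^sup>2 = 1" and z: "z \<in> unit_sphere"
    and nz: "1 + of_real a * z $ i \<noteq> 0"
  shows "boost i a b z \<in> unit_sphere"
proof -
  let ?S = "\<Sum>k\<in>UNIV - {i}. cnj (z $ k) * z $ k" and ?D = "1 + of_real a * z $ i"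
  have ab': "(of_real a)\<^sup>2 + (of_real b)\<^sup>2 = (1::complex)"
    using arg_cong[OF ab, of complex_of_real] by simp
  have nz': "cnj ?D \<noteq> 0" using nz by (simp only: complex_cnj_zero_iff) simp
  have S: "?S = 1 - cnj (z $ i) * z $ i"
    using z herm_remove[of z z i] unfolding mem_unit_sphere_iff_herm
    by (simp only: eq_diff_eq add.commute)
  have "(\<Sum>k\<in>UNIV - {i}. cnj (boost i a b z $ k) * boost i a b z $ k)
      = (\<Sum>k\<in>UNIV - {i}. (of_real b)\<^sup>2 / (cnj ?D * ?D) * (cnj (z $ k) * z $ k))"
    by (intro sum.cong) (auto simp: boost_def power2_eq_square)
  also have "\<dots> = (of_real b)\<^sup>2 / (cnj ?D * ?D) * ?S"
    by (simp only: sum_distrib_left)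
  finally have "herm (boost i a b z) (boost i a b z) =
      ((cnj (z $ i) + of_real a) * (z $ i + of_real a) + (of_real b)\<^sup>2 * ?S) / (cnj ?D * ?D)"
    unfolding herm_remove[of _ _ i] add_divide_distrib[of "_ * _"] by (simp add: boost_def)
  also have "(cnj (z $ i) + of_real a) * (z $ i + of_real a) + (of_real b)\<^sup>2 * ?S = cnj ?D * ?D"
    unfolding S complex_cnj_add complex_cnj_mult complex_cnj_complex_of_real complex_cnj_one
    using ab' by algebra
  also have "cnj ?D * ?D / (cnj ?D * ?D) = 1" using nz nz' by simp
  finally show ?thesis unfolding mem_unit_sphere_iff_herm .
qed

lemma boost_boost_minus:
  fixes z :: "complex ^ 'n"
  assumes ab: "a\<^sup>2 + b\<^sup>2 = 1" and "b \<noteq> 0" and nz: "1 + of_real a * z $ i \<noteq> 0"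
  shows "boost i (- a) b (boost i a b z) = z"
proof -
  let ?D = "1 + of_real a * z $ i"
  have ab': "(of_real a)\<^sup>2 + (of_real b)\<^sup>2 = (1::complex)"
    using arg_cong[OF ab, of complex_of_real] by simp
  have b2: "(of_real b)\<^sup>2 = 1 - of_real a * (of_real a :: complex)"
    using ab' by (simp add: eq_diff_eq add.commute power2_eq_square)
  have D': "1 + of_real (- a) * boost i a b z $ i = (of_real b)\<^sup>2 / ?D"
    using nz unfolding b2 by (simp add: boost_def field_simps)
  have N: "boost i a b z $ i + of_real (- a) = (of_real b)\<^sup>2 * z $ i / ?D"
    using nz unfolding b2 by (simp add: boost_def field_simps)
  have "boost i (- a) b (boost i a b z) $ k = z $ k" for k
  proof (cases "k = i")
    case True
    then show ?thesis
      unfolding boost_def[of i "- a"] vec_lambda_beta N D' using nz \<open>b \<noteq> 0\<close> by simp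
  next
    case False
    then have "boost i a b z $ k = of_real b * z $ k / ?D" by (simp add: boost_def)
    with False show ?thesis
      unfolding boost_def[of i "- a"] vec_lambda_beta D'
      using nz \<open>b \<noteq> 0\<close> by (simp add: power2_eq_square)
  qed
  then show ?thesis by (simp add: vec_eq_iff)
qed

text \<open>
  The same isometry, polarized: \<open>herm N N' - cnj D \<cdot> D' = b\<^sup>2 herm z v\<close> for the linear parts \<open>N'\<close>, \<open>D'\<close>
  evaluated at \<open>v\<close>. The term \<open>cnj D \<cdot> D'\<close> is cancelled by the derivative of the denominator, since the
  image point has norm \<open>1\<close>.
\<close>

lemma alpha_std_boost:
  fixes z :: "complex ^ 'n"
  assumes ab: "a\<^sup>2 + b\<^sup>2 = 1" and z: "z \<in> unit_sphere"
    and nz: "1 + of_real a * z $ i \<noteq> 0"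
  shows "alpha_std (boost i a b z) (boost_deriv i a b z v) =
    b\<^sup>2 / (norm (1 + of_real a * z $ i))\<^sup>2 * alpha_std z v"
proof -
  let ?D = "1 + of_real a * z $ i" and ?w = "boost i a b z"
  let ?N = "\<lambda>v k. if k = i then v $ i else of_real b * v $ k"
  let ?S = "\<Sum>k\<in>UNIV - {i}. cnj (z $ k) * v $ k"
  have ab': "(of_real a)\<^sup>2 + (of_real b)\<^sup>2 = (1::complex)"
    using arg_cong[OF ab, of complex_of_real] by simp
  have nz': "cnj ?D \<noteq> 0" using nz by (simp only: complex_cnj_zero_iff) simp
  have "(\<Sum>k\<in>UNIV. cnj (?w $ k) * ?N v k) =
      cnj (?w $ i) * v $ i + (\<Sum>k\<in>UNIV - {i}. cnj (?w $ k) * ?N v k)"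
    by (subst sum.remove[of _ i]) auto
  also have "(\<Sum>k\<in>UNIV - {i}. cnj (?w $ k) * ?N v k) =
      (\<Sum>k\<in>UNIV - {i}. (of_real b)\<^sup>2 / cnj ?D * (cnj (z $ k) * v $ k))"
    by (intro sum.cong) (auto simp: boost_def power2_eq_square)
  also have "\<dots> = (of_real b)\<^sup>2 / cnj ?D * ?S"
    by (simp only: sum_distrib_left)
  also have "cnj (?w $ i) * v $ i + (of_real b)\<^sup>2 / cnj ?D * ?S =
      ((cnj (z $ i) + of_real a) * v $ i + (of_real b)\<^sup>2 * ?S) / cnj ?D"
    unfolding add_divide_distrib[of "_ * _"] by (simp add: boost_def)
  also have "(cnj (z $ i) + of_real a) * v $ i + (of_real b)\<^sup>2 * ?S =
      cnj ?D * (of_real a * v $ i) + (of_real b)\<^sup>2 * herm z v"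
    unfolding herm_remove[of z v i] complex_cnj_add complex_cnj_mult complex_cnj_complex_of_real
      complex_cnj_one
    using ab' by algebra
  also have "\<dots> / cnj ?D = of_real a * v $ i + (of_real b)\<^sup>2 * herm z v / cnj ?D"
    unfolding add_divide_distrib nonzero_mult_div_cancel_left[OF nz'] ..
  finally have N: "(\<Sum>k\<in>UNIV. cnj (?w $ k) * ?N v k) =
      of_real a * v $ i + (of_real b)\<^sup>2 * herm z v / cnj ?D" .
  have "herm ?w (boost_deriv i a b z v) =
      ((\<Sum>k\<in>UNIV. cnj (?w $ k) * ?N v k) - herm ?w ?w * (of_real a * v $ i)) / ?D"
  proof -
    have "cnj (?w $ k) * boost_deriv i a b z v $ k =
        (cnj (?w $ k) * ?N v k - cnj (?w $ k) * ?w $ k * (of_real a * v $ i)) / ?D" for k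
      unfolding boost_deriv_def vec_lambda_beta
      by (simp only: right_diff_distrib mult.assoc times_divide_eq_right)
    then show ?thesis
      unfolding herm_def sum_distrib_right
      by (simp only: sum_subtractf sum_divide_distrib[symmetric])
  qed
  also have "\<dots> = (of_real b)\<^sup>2 * herm z v / (?D * cnj ?D)"
    using boost_in_unit_sphere[OF assms] unfolding mem_unit_sphere_iff_herm N
    by (simp add: mult.commute)
  also have "\<dots> = of_real (b\<^sup>2 / (norm ?D)\<^sup>2) * herm z v"
    unfolding complex_norm_square[symmetric] by simp
  finally show ?thesis
    unfolding alpha_std_eq_Im_herm
    by (simp only: Im_complex_of_real Re_complex_of_real times_complex.sel mult_zero_left
        add_0_right)
qed

lemma boost_has_derivative:
  fixes z :: "complex ^ 'n"
  assumes nz: "1 + of_real a * z $ i \<noteq> 0"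
  shows "(boost i a b has_derivative boost_deriv i a b z) (at z)"
proof (rule has_derivative_vec)
  fix k
  let ?N = "\<lambda>z. if k = i then z $ i + of_real a else of_real b * z $ k"
  have nth: "((\<lambda>z. z $ k) has_derivative (\<lambda>v. v $ k)) (at z)" for k
    by (rule bounded_linear_imp_has_derivative[OF bounded_linear_vec_nth])
  have N: "(?N has_derivative (\<lambda>v. if k = i then v $ i else of_real b * v $ k)) (at z)"
    by (cases "k = i") (auto intro!: has_derivative_add_const has_derivative_mult_right nth)
  have D: "((\<lambda>z. 1 + of_real a * z $ i) has_derivative (\<lambda>v. of_real a * v $ i)) (at z)"
    using has_derivative_add[OF has_derivative_const[of 1] has_derivative_mult_right[OF nth[of i]]]
    by simp
  have "(x * d - y * e) / (d * d) = (x - y / d * e) / d" if "d \<noteq> 0" for x y d e :: complex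
    using that by (simp add: field_simps)
  note quotient = this[OF nz]
  have "((\<lambda>z. ?N z / (1 + of_real a * z $ i)) has_derivative
      (\<lambda>v. ((if k = i then v $ i else of_real b * v $ k) * (1 + of_real a * z $ i)
        - ?N z * (of_real a * v $ i)) / ((1 + of_real a * z $ i) * (1 + of_real a * z $ i)))) (at z)"
    by (rule has_derivative_divide'[OF N D]) (rule nz)
  then show "((\<lambda>z. boost i a b z $ k) has_derivative (\<lambda>v. boost_deriv i a b z v $ k)) (at z)"
    unfolding quotient by (simp only: boost_def boost_deriv_def vec_lambda_beta)
qed

lemma rot_rot_minus:
  assumes "i \<noteq> j" "c\<^sup>2 + s\<^sup>2 = 1"
  shows "rot i j c (- s) (rot i j c s z) = z"
proof -
  have cs: "(of_real c)\<^sup>2 + (of_real s)\<^sup>2 = (1::complex)"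
    using arg_cong[OF assms(2), of complex_of_real] by simp
  have "of_real c * (of_real c * x - of_real s * y) + of_real s * (of_real s * x + of_real c * y) =
      ((of_real c)\<^sup>2 + (of_real s)\<^sup>2) * x"
    "of_real c * (of_real s * x + of_real c * y) - of_real s * (of_real c * x - of_real s * y) =
      ((of_real c)\<^sup>2 + (of_real s)\<^sup>2) * y" for x y :: complex
    by (simp_all add: power2_eq_square algebra_simps)
  then show ?thesis
    using assms(1) by (auto simp: vec_eq_iff rot_def cs)
qed

lemma herm_rot:
  assumes "i \<noteq> j" "c\<^sup>2 + s\<^sup>2 = 1"
  shows "herm (rot i j c s z) (rot i j c s v) = herm z v"
proof -
  have cs: "(of_real c)\<^sup>2 + (of_real s)\<^sup>2 = (1::complex)"
    using arg_cong[OF assms(2), of complex_of_real] by simp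
  have split: "herm z v = cnj (z $ i) * v $ i + (cnj (z $ j) * v $ j +
      (\<Sum>k\<in>UNIV - {i} - {j}. cnj (z $ k) * v $ k))" for z v :: "complex ^ 'a"
    unfolding herm_remove[of z v i] using assms(1) by (subst sum.remove[of _ j]) auto
  have "(\<Sum>k\<in>UNIV - {i} - {j}. cnj (rot i j c s z $ k) * rot i j c s v $ k) =
      (\<Sum>k\<in>UNIV - {i} - {j}. cnj (z $ k) * v $ k)"
    by (intro sum.cong) (auto simp: rot_def)
  moreover have "cnj (rot i j c s z $ i) * rot i j c s v $ i +
      cnj (rot i j c s z $ j) * rot i j c s v $ j = cnj (z $ i) * v $ i + cnj (z $ j) * v $ j"
  proof -
    have "?thesis \<longleftrightarrow> ((of_real c)\<^sup>2 + (of_real s)\<^sup>2) *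
        (cnj (z $ i) * v $ i + cnj (z $ j) * v $ j) = cnj (z $ i) * v $ i + cnj (z $ j) * v $ j"
      using assms(1) by (simp add: rot_def power2_eq_square algebra_simps)
    then show ?thesis unfolding cs by simp
  qed
  ultimately show ?thesis unfolding split[of z] split[of "rot i j c s z"]
    by (simp add: add.assoc[symmetric])
qed

lemma rot_in_unit_sphere:
  assumes "i \<noteq> j" "c\<^sup>2 + s\<^sup>2 = 1"
  shows "rot i j c s z \<in> unit_sphere \<longleftrightarrow> z \<in> unit_sphere"
  unfolding mem_unit_sphere_iff_herm herm_rot[OF assms] ..

lemma bounded_linear_rot: "bounded_linear (rot i j c s)"
  unfolding linear_conv_bounded_linear[symmetric]
  by (intro linearI) (simp_all add: rot_def vec_eq_iff algebra_simps)

section \<open>The contact isotopy\<close>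

lemma smooth_onI:
  assumes "open U" "A \<subseteq> U" "\<And>k. Ck_on k h U" "\<And>y. y \<in> A \<Longrightarrow> h y = f y"
  shows "smooth_on A f"
  using assms unfolding smooth_on_def by blast

lemma Ck_on_boost:
  assumes U: "open U" and f: "Ck_on m f U" and a: "Ck_on m a U" and b: "Ck_on m b U"
    and nz: "\<And>x. x \<in> U \<Longrightarrow> 1 + of_real (a x) * f x $ i \<noteq> 0"
  shows "Ck_on m (\<lambda>x. boost i (a x) (b x) (f x)) U"
proof (rule Ck_on_vec[OF U])
  fix k
  have "Ck_on m (\<lambda>x. if k = i then f x $ i + of_real (a x) else of_real (b x) * f x $ k) U"
  proof (cases "k = i")
    case True
    have "Ck_on m (\<lambda>x. f x $ i + of_real (a x)) U"
      by (intro Ck_on_add Ck_on_nth Ck_on_complex_of_real U f a)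
    with True show ?thesis by simp
  next
    case False
    have "Ck_on m (\<lambda>x. of_real (b x) * f x $ k) U"
      by (intro Ck_on_mult Ck_on_nth Ck_on_complex_of_real U f b)
    with False show ?thesis by simp
  qed
  then show "Ck_on m (\<lambda>x. boost i (a x) (b x) (f x) $ k) U"
    unfolding boost_def vec_lambda_beta divide_inverse
    by (intro Ck_on_mult Ck_on_inverse Ck_on_add Ck_on_const Ck_on_nth Ck_on_complex_of_real
        U f a nz)
qed

lemma Ck_on_rot:
  assumes U: "open U" and f: "Ck_on m f U" and c: "Ck_on m c U" and s: "Ck_on m s U"
  shows "Ck_on m (\<lambda>x. rot i j (c x) (s x) (f x)) U"
proof (rule Ck_on_vec[OF U])
  fix k
  have "Ck_on m (\<lambda>x. of_real (c x) * f x $ i + of_real (- s x) * f x $ j) U"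
    by (intro Ck_on_add Ck_on_mult Ck_on_nth Ck_on_complex_of_real
        Ck_on_bounded_linear[OF bounded_linear_minus[OF bounded_linear_ident]] U f c s)
  moreover have "Ck_on m (\<lambda>x. of_real (s x) * f x $ i + of_real (c x) * f x $ j) U"
    by (intro Ck_on_add Ck_on_mult Ck_on_nth Ck_on_complex_of_real U f c s)
  moreover have "Ck_on m (\<lambda>x. f x $ k) U"
    by (intro Ck_on_nth U f)
  ultimately show "Ck_on m (\<lambda>x. rot i j (c x) (s x) (f x) $ k) U"
    by (cases "k = i"; cases "k = j") (simp_all add: rot_def)
qed

lemma open_boost_domain:
  fixes i :: "'n::finite"
  shows "open {z :: complex ^ 'n. 1 + of_real a * z $ i \<noteq> 0}"
  by (intro open_Collect_neq continuous_intros)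

lemma abs_lt_1_if_squares: "a\<^sup>2 + b\<^sup>2 = 1 \<Longrightarrow> b \<noteq> 0 \<Longrightarrow> \<bar>a\<bar> < (1::real)"
  using zero_less_power2[of b] abs_square_less_1[of a] by linarith

text \<open>
  The inverse is the opposite rotation followed by the opposite boost, hence of the same rational
  kind.
\<close>

lemma sphere_diffeo_rot_boost:
  fixes i j :: "'n::finite"
  assumes ij: "i \<noteq> j" and cs: "c\<^sup>2 + s\<^sup>2 = 1" and ab: "a\<^sup>2 + b\<^sup>2 = 1" and b: "b \<noteq> 0"
  shows "sphere_diffeo (\<lambda>z :: complex ^ 'n. rot i j c s (boost i a b z))"
proof -
  let ?\<phi> = "\<lambda>z :: complex ^ 'n. rot i j c s (boost i a b z)"
  let ?\<psi> = "\<lambda>z :: complex ^ 'n. boost i (- a) b (rot i j c (- s) z)"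
  have ab': "(- a)\<^sup>2 + b\<^sup>2 = 1" and cs': "c\<^sup>2 + (- s)\<^sup>2 = 1" using ab cs by simp_all
  note a = abs_lt_1_if_squares[OF ab b]
  note a' = abs_lt_1_if_squares[OF ab' b]
  have \<phi>: "?\<phi> z \<in> unit_sphere" and \<psi>\<phi>: "?\<psi> (?\<phi> z) = z" if "z \<in> unit_sphere" for z :: "complex ^ 'n"
    unfolding rot_in_unit_sphere[OF ij cs] rot_rot_minus[OF ij cs]
    by (intro boost_in_unit_sphere boost_boost_minus boost_denominator_nonzero ab a b that)+
  have \<psi>: "?\<psi> z \<in> unit_sphere" and \<phi>\<psi>: "?\<phi> (?\<psi> z) = z" if "z \<in> unit_sphere" for z :: "complex ^ 'n"
  proof -
    let ?w = "rot i j c (- s) z"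
    have w: "?w \<in> unit_sphere" using that unfolding rot_in_unit_sphere[OF ij cs'] .
    show "?\<psi> z \<in> unit_sphere"
      by (rule boost_in_unit_sphere[OF ab' w boost_denominator_nonzero[OF a' w]])
    show "?\<phi> (?\<psi> z) = z"
      using boost_boost_minus[OF ab' b boost_denominator_nonzero[OF a' w]]
        rot_rot_minus[OF ij cs', of z] by (simp only: minus_minus)
  qed
  have bij: "bij_betw ?\<phi> unit_sphere unit_sphere"
    by (rule bij_betw_byWitness[where f' = ?\<psi>])
      (intro ballI \<psi>\<phi> \<phi>\<psi> image_subsetI \<phi> \<psi>; assumption)+
  have inv: "?\<psi> y = inv_into unit_sphere ?\<phi> y" if "y \<in> unit_sphere" for y
    by (rule inv_into_f_eq[OF bij_betw_imp_inj_on[OF bij] \<psi>[OF that] \<phi>\<psi>[OF that], symmetric])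
  have "smooth_on unit_sphere ?\<phi>"
  proof (rule smooth_onI[OF open_boost_domain[of a i]])
    show "Ck_on k ?\<phi> {z. 1 + of_real a * z $ i \<noteq> 0}" for k
      by (intro Ck_on_rot Ck_on_boost Ck_on_id Ck_on_const open_boost_domain) simp
    show "unit_sphere \<subseteq> {z :: complex ^ 'n. 1 + of_real a * z $ i \<noteq> 0}"
      by (rule subsetI CollectI boost_denominator_nonzero[OF a])+
  qed simp
  moreover have "smooth_on unit_sphere (inv_into unit_sphere ?\<phi>)"
  proof (rule smooth_onI)
    let ?U = "{z :: complex ^ 'n. 1 + of_real (- a) * rot i j c (- s) z $ i \<noteq> 0}"
    show U: "open ?U"
      by (intro open_Collect_neq continuous_intros
          linear_continuous_on[OF bounded_linear_rot])
    show "Ck_on k ?\<psi> ?U" for k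
      by (intro Ck_on_rot Ck_on_boost Ck_on_id Ck_on_const U) simp
    show "unit_sphere \<subseteq> ?U"
    proof clarify
      fix z :: "complex ^ 'n"
      assume "z \<in> unit_sphere" "1 + of_real (- a) * rot i j c (- s) z $ i = 0"
      then show False
        using boost_denominator_nonzero[OF a', of "rot i j c (- s) z" i]
        unfolding rot_in_unit_sphere[OF ij cs'] by simp
    qed
  qed (rule inv)
  ultimately show ?thesis using bij by (simp add: sphere_diffeo_def)
qed

lemma alpha_std_rot_boost_derivative:
  fixes p :: "complex ^ 'n"
  assumes ij: "i \<noteq> j" and cs: "c\<^sup>2 + s\<^sup>2 = 1" and ab: "a\<^sup>2 + b\<^sup>2 = 1" and b: "b \<noteq> 0"
    and p: "p \<in> unit_sphere" and v: "v \<in> tangent_space p"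
  defines "\<phi> \<equiv> \<lambda>z :: complex ^ 'n. rot i j c s (boost i a b z)"
  shows "alpha_std (\<phi> p) (frechet_derivative \<phi> (at p within unit_sphere) v) =
    b\<^sup>2 / (norm (1 + of_real a * p $ i))\<^sup>2 * alpha_std p v"
proof -
  note nz = boost_denominator_nonzero[OF abs_lt_1_if_squares[OF ab b] p, of i]
  have D: "(\<phi> has_derivative (\<lambda>v. rot i j c s (boost_deriv i a b p v))) (at p within unit_sphere)"
    unfolding \<phi>_def
    by (intro bounded_linear.has_derivative[OF bounded_linear_rot]
        has_derivative_at_withinI[OF boost_has_derivative] nz)
  have "frechet_derivative \<phi> (at p within unit_sphere) v = rot i j c s (boost_deriv i a b p v)"
    by (rule sphere_derivative_unique[OF p v frechet_derivative_works[THEN iffD1, OF differentiableI[OF D]] D])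
  then have "alpha_std (\<phi> p) (frechet_derivative \<phi> (at p within unit_sphere) v) =
      alpha_std (boost i a b p) (boost_deriv i a b p v)"
    by (simp only: alpha_std_eq_Im_herm herm_rot[OF ij cs] \<phi>_def)
  then show ?thesis
    using alpha_std_boost[OF ab p nz] by simp
qed

lemma contactomorphism_rot_boost:
  fixes i j :: "'n::finite"
  assumes ij: "i \<noteq> j" and cs: "c\<^sup>2 + s\<^sup>2 = 1" and ab: "a\<^sup>2 + b\<^sup>2 = 1" and b: "b \<noteq> 0"
  shows "contactomorphism alpha_std (\<lambda>z :: complex ^ 'n. rot i j c s (boost i a b z))"
proof -
  let ?D = "\<lambda>z :: complex ^ 'n. 1 + of_real a * z $ i"
    and ?U = "{z :: complex ^ 'n. 1 + of_real a * z $ i \<noteq> 0}"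
  \<comment> \<open>\<open>|D|\<^sup>2\<close> is written as an inner product, which is bilinear and hence visibly smooth.\<close>
  let ?g = "\<lambda>z. ln (b\<^sup>2 * inverse (?D z \<bullet> ?D z))"
  note nz = boost_denominator_nonzero[OF abs_lt_1_if_squares[OF ab b]]
  have D: "Ck_on k ?D ?U" for k
    by (intro Ck_on_add Ck_on_const Ck_on_mult Ck_on_nth Ck_on_id open_boost_domain)
  have "Ck_on k ?g ?U" for k
    by (intro Ck_on_ln Ck_on_mult Ck_on_const Ck_on_inverse
        Ck_on_bounded_bilinear[OF bounded_bilinear_inner] D open_boost_domain)
      (use b in auto)
  moreover have "unit_sphere \<subseteq> ?U"
    by (rule subsetI CollectI nz)+
  ultimately have "smooth_on unit_sphere ?g"
    by (intro smooth_onI[OF open_boost_domain[of a i], where h = ?g]) auto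
  moreover have exp: "exp (?g p) = b\<^sup>2 / (norm (?D p))\<^sup>2" if "p \<in> unit_sphere" for p
    using b nz[OF that, of i] by (simp add: power2_norm_eq_inner divide_inverse)
  ultimately have "scaling_factor alpha_std (\<lambda>z. rot i j c s (boost i a b z)) ?g"
    unfolding scaling_factor_def
  proof (intro conjI ballI)
    fix p v :: "complex ^ 'n"
    assume p: "p \<in> unit_sphere" and v: "v \<in> tangent_space p"
    show "alpha_std (rot i j c s (boost i a b p))
        (frechet_derivative (\<lambda>z. rot i j c s (boost i a b z)) (at p within unit_sphere) v) =
      exp (?g p) * alpha_std p v"
      unfolding exp[OF p] by (rule alpha_std_rot_boost_derivative[OF assms p v])
  qed
  then show ?thesis
    using sphere_diffeo_rot_boost[OF assms] unfolding contactomorphism_def by blast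
qed

text \<open>
  The circle in the parameter \<open>t = tan (\<theta> / 2)\<close>, by which the isotopy is rational in time; \<open>t = 1\<close> is
  the quarter turn and \<open>t = 3/4\<close> the Pythagorean triple \<open>7, 24, 25\<close>.
\<close>

definition rational_cos :: "real \<Rightarrow> real" where
  "rational_cos t = (1 - t\<^sup>2) / (1 + t\<^sup>2)"

definition rational_sin :: "real \<Rightarrow> real" where
  "rational_sin t = 2 * t / (1 + t\<^sup>2)"

lemma one_plus_square_nonzero: "1 + t\<^sup>2 \<noteq> (0::real)"
  by (metis add_pos_nonneg less_irrefl zero_le_power2 zero_less_one)

lemma rational_cos_sin: "(rational_cos t)\<^sup>2 + (rational_sin t)\<^sup>2 = 1"
proof -
  have "(1 - t\<^sup>2)\<^sup>2 + (2 * t)\<^sup>2 = (1 + t\<^sup>2)\<^sup>2" by (simp add: power2_eq_square algebra_simps)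
  then show ?thesis
    unfolding rational_cos_def rational_sin_def power_divide add_divide_distrib[symmetric]
    using one_plus_square_nonzero[of t] by simp
qed

lemma Ck_on_rational:
  assumes U: "open U" and f: "Ck_on m f U"
  shows "Ck_on m (\<lambda>x. rational_cos (f x)) U" and "Ck_on m (\<lambda>x. rational_sin (f x)) U"
proof -
  have inv: "Ck_on m (\<lambda>x. inverse (1 + f x * f x)) U"
    using one_plus_square_nonzero
    by (intro Ck_on_inverse Ck_on_add Ck_on_const Ck_on_mult U f) (simp add: power2_eq_square)
  have "Ck_on m (\<lambda>x. (1 + (- 1) * (f x * f x)) * inverse (1 + f x * f x)) U"
    by (intro Ck_on_add Ck_on_const Ck_on_mult U f inv)
  then show "Ck_on m (\<lambda>x. rational_cos (f x)) U"
    by (simp add: rational_cos_def divide_inverse power2_eq_square)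
  have "Ck_on m (\<lambda>x. 2 * f x * inverse (1 + f x * f x)) U"
    by (intro Ck_on_const Ck_on_mult U f inv)
  then show "Ck_on m (\<lambda>x. rational_sin (f x)) U"
    by (simp add: rational_sin_def divide_inverse power2_eq_square)
qed

text \<open>
  The factor \<open>3/4\<close> makes the boost at time \<open>1\<close> the one with \<open>a = 24/25\<close> and \<open>b = 7/25\<close>, and keeps
  \<open>b > 0\<close> on \<open>[0, 1]\<close>; at time \<open>1\<close> the rotation is by a quarter turn.
\<close>

definition boost_rotation_isotopy :: "'n \<Rightarrow> 'n \<Rightarrow> real \<Rightarrow> complex ^ 'n \<Rightarrow> complex ^ 'n" where
  "boost_rotation_isotopy i j t z =
     rot i j (rational_cos t) (rational_sin t)
       (boost i (rational_sin (3 / 4 * t)) (rational_cos (3 / 4 * t)) z)"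

lemma rational_cos_nonzero:
  assumes "t \<in> {0..1}"
  shows "rational_cos (3 / 4 * t) \<noteq> 0"
proof -
  have "3 / 4 * t < 1" "0 \<le> 3 / 4 * t" using assms by auto
  then have "(3 / 4 * t)\<^sup>2 < 1" by (simp only: abs_square_less_1 abs_of_nonneg)
  then show ?thesis
    unfolding rational_cos_def using one_plus_square_nonzero[of "3 / 4 * t"] by simp
qed

lemma contactomorphism_boost_rotation_isotopy:
  assumes "i \<noteq> j" "t \<in> {0..1}"
  shows "contactomorphism alpha_std (boost_rotation_isotopy i j t)"
proof -
  let ?a = "rational_sin (3 / 4 * t)" and ?b = "rational_cos (3 / 4 * t)"
  have "?a\<^sup>2 + ?b\<^sup>2 = 1" using rational_cos_sin[of "3 / 4 * t"] by (simp only: add.commute)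
  then show ?thesis
    unfolding boost_rotation_isotopy_def
    by (rule contactomorphism_rot_boost[OF assms(1) rational_cos_sin _
          rational_cos_nonzero[OF assms(2)]])
qed

lemma smooth_on_boost_rotation_isotopy:
  fixes i j :: "'n::finite"
  shows "smooth_on ({0..1} \<times> (unit_sphere :: (complex ^ 'n) set))
    (\<lambda>(t, z). boost_rotation_isotopy i j t z)"
proof (rule smooth_onI)
  let ?a = "\<lambda>x :: real \<times> (complex ^ 'n). rational_sin (3 / 4 * fst x)"
  let ?U = "{x :: real \<times> (complex ^ 'n). 1 + of_real (?a x) * snd x $ i \<noteq> 0}"
  let ?h = "\<lambda>x :: real \<times> (complex ^ 'n). boost_rotation_isotopy i j (fst x) (snd x)"
  have t: "Ck_on k (\<lambda>x :: real \<times> (complex ^ 'n). 3 / 4 * fst x) V"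
    and t': "Ck_on k (\<lambda>x :: real \<times> (complex ^ 'n). fst x) V"
    and z: "Ck_on k (\<lambda>x :: real \<times> (complex ^ 'n). snd x) V" if "open V" for k V
    by (intro Ck_on_mult Ck_on_const Ck_on_bounded_linear[OF bounded_linear_fst]
        Ck_on_bounded_linear[OF bounded_linear_snd] Ck_on_id that)+
  have a: "continuous_on UNIV ?a"
    using Ck_on_rational(2)[OF open_UNIV t[OF open_UNIV], of 0] by simp
  show U: "open ?U"
    by (intro open_Collect_neq continuous_intros a)
  show "Ck_on k ?h ?U" for k
    unfolding boost_rotation_isotopy_def
    by (intro Ck_on_rot Ck_on_boost Ck_on_rational t t' z U) simp
  show "{0..1} \<times> unit_sphere \<subseteq> ?U"
  proof
    fix x :: "real \<times> (complex ^ 'n)"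
    assume "x \<in> {0..1} \<times> unit_sphere"
    then have t: "fst x \<in> {0..1}" and z: "snd x \<in> unit_sphere" by auto
    have "(?a x)\<^sup>2 + (rational_cos (3 / 4 * fst x))\<^sup>2 = 1"
      using rational_cos_sin[of "3 / 4 * fst x"] by (simp only: add.commute)
    from boost_denominator_nonzero[OF abs_lt_1_if_squares[OF this rational_cos_nonzero[OF t]] z]
    show "x \<in> ?U" by (rule CollectI)
  qed
  show "?h x = (case x of (t, z) \<Rightarrow> boost_rotation_isotopy i j t z)" for x
    by (simp add: case_prod_beta)
qed

lemma boost_rotation_isotopy_0: "boost_rotation_isotopy i j 0 z = z"
  by (simp add: boost_rotation_isotopy_def rational_cos_def rational_sin_def rot_def boost_def
      vec_eq_iff)

lemma contact_isotopic_to_id_boost_rotation: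
  fixes i j :: "'n::finite"
  assumes "i \<noteq> j"
  shows "contact_isotopic_to_id alpha_std (boost_rotation_isotopy i j 1)"
  unfolding contact_isotopic_to_id_def
  using smooth_on_boost_rotation_isotopy[of i j] contactomorphism_boost_rotation_isotopy[OF assms]
    boost_rotation_isotopy_0[of i j]
  by (intro exI[of _ "boost_rotation_isotopy i j"]) simp

section \<open>Absence of translated points\<close>

text \<open>
  The condition \<open>g p = 0\<close> says that the conformal factor is \<open>1\<close> at \<open>p\<close>. To read this off for an
  arbitrary scaling factor \<open>g\<close>, evaluate both sides on the Reeb vector \<open>\<i>p\<close>, where \<open>\<alpha>\<close> does not vanish.
\<close>

lemma translated_point_unit_denominator:
  fixes p :: "complex ^ 'n"
  assumes ij: "i \<noteq> j" and cs: "c\<^sup>2 + s\<^sup>2 = 1" and ab: "a\<^sup>2 + b\<^sup>2 = 1" and b: "b \<noteq> 0"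
    and tp: "translated_point alpha_std (\<lambda>z. rot i j c s (boost i a b z)) p"
  shows "(norm (1 + of_real a * p $ i))\<^sup>2 = b\<^sup>2"
proof -
  let ?\<phi> = "\<lambda>z :: complex ^ 'n. rot i j c s (boost i a b z)"
  obtain g where p: "p \<in> unit_sphere" and g: "scaling_factor alpha_std ?\<phi> g" "g p = 0"
    using tp unfolding translated_point_def by blast
  have "p \<bullet> (\<i> *s p) = 0"
    using alpha_std_antisym[of p p] by (simp add: alpha_std_eq_inner inner_commute)
  then have v: "\<i> *s p \<in> tangent_space p" by (simp add: tangent_space_def)
  have "(\<i> *s p) \<bullet> (\<i> *s p) = p \<bullet> p"
    by (simp add: inner_vec_def inner_complex_def add.commute)
  then have one: "alpha_std p (\<i> *s p) = 1"
    using p by (simp add: alpha_std_eq_inner norm_eq_1)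
  have "alpha_std (?\<phi> p) (frechet_derivative ?\<phi> (at p within unit_sphere) (\<i> *s p)) = 1"
    using g p v one unfolding scaling_factor_def by simp
  then have "b\<^sup>2 / (norm (1 + of_real a * p $ i))\<^sup>2 = 1"
    using alpha_std_rot_boost_derivative[OF ij cs ab b p v] unfolding one by linarith
  then show ?thesis using b by (simp add: divide_eq_1_iff)
qed

lemma no_translated_point:
  fixes p :: "complex ^ 'n"
  assumes ij: "i \<noteq> j"
  shows "\<not> translated_point alpha_std (boost_rotation_isotopy i j 1) p"
proof
  let ?\<phi> = "boost_rotation_isotopy i j 1 :: complex ^ 'n \<Rightarrow> complex ^ 'n"
  let ?a = "24 / 25 :: real" and ?b = "7 / 25 :: real"
  assume tp: "translated_point alpha_std ?\<phi> p"
  have \<phi>: "?\<phi> = (\<lambda>z. rot i j 0 1 (boost i ?a ?b z))"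
    by (simp add: fun_eq_iff boost_rotation_isotopy_def rational_cos_def rational_sin_def
        power2_eq_square)
  let ?D = "1 + of_real ?a * p $ i"
  have D: "(norm ?D)\<^sup>2 = ?b\<^sup>2"
    by (rule translated_point_unit_denominator[OF ij _ _ _ tp[unfolded \<phi>]])
      (simp_all add: power2_eq_square)
  then have nD: "norm ?D = ?b" by (simp only: power2_eq_iff_nonneg norm_ge_zero)
  have "1 \<le> norm ?D + norm (of_real ?a * p $ i)"
    using norm_triangle_ineq4[of ?D "of_real ?a * p $ i"] by simp
  then have big: "norm (p $ i) \<ge> 3 / 4"
    unfolding nD norm_mult norm_of_real by simp
  obtain \<gamma> where "reeb_flow_line alpha_std \<gamma>" "p \<in> range \<gamma>" "?\<phi> p \<in> range \<gamma>"
    using tp unfolding translated_point_def by blast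
  then have "norm (p $ i) = norm (?\<phi> p $ i)"
    by (rule reeb_flow_line_norm_nth)
  also have "?\<phi> p $ i = - (of_real ?b * p $ j / ?D)"
    unfolding \<phi> using ij by (simp add: rot_def boost_def)
  also have "norm \<dots> = norm (p $ j)"
    unfolding norm_minus_cancel norm_divide norm_mult nD by simp
  finally have "norm (p $ i) = norm (p $ j)" .
  moreover have "(norm (p $ i))\<^sup>2 + (norm (p $ j))\<^sup>2 \<le> 1"
  proof -
    have "(norm (p $ i))\<^sup>2 + (norm (p $ j))\<^sup>2 = (\<Sum>k\<in>{i, j}. (norm (p $ k))\<^sup>2)"
      using ij by simp
    also have "\<dots> \<le> (\<Sum>k\<in>UNIV. (norm (p $ k))\<^sup>2)"
      by (rule sum_mono2) auto
    also have "\<dots> = (norm p)\<^sup>2"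
      by (simp add: norm_vec_def L2_set_def sum_nonneg)
    also have "\<dots> = 1"
      using tp by (simp add: translated_point_def)
    finally show ?thesis .
  qed
  ultimately show False
    using power_mono[OF big, of 2] by (simp add: power2_eq_square)
qed

theorem theorem1:
  assumes "CARD('n::finite) > 1"
  shows "\<exists>\<phi> :: complex ^ 'n \<Rightarrow> complex ^ 'n.
           contactomorphism alpha_std \<phi> \<and>
           contact_isotopic_to_id alpha_std \<phi> \<and>
           \<not> (\<exists>p. translated_point alpha_std \<phi> p)"
proof -
  obtain i j :: 'n where "i \<noteq> j"
    using assms by (metis UNIV_not_empty is_singletonI' is_singleton_altdef less_irrefl_nat)
  then show ?thesis
    using contactomorphism_boost_rotation_isotopy[of i j 1]
      contact_isotopic_to_id_boost_rotation[of i j] no_translated_point[of i j]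
    by (intro exI[of _ "boost_rotation_isotopy i j 1"]) simp
qed

end
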